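(* Let $x_0\in\operatorname{int}(\operatorname{dom}\psi)$, $\delta\ge0$, and $L>0$ with $L\ge L_d(f)$. Let the sequence $\{x_k\}_{k\ge1}$ be generated from $x_0$ by the Inexact Gradient Method with Memory (defined in the context) with parameters $L$ and $\delta$, where the sets $\mathcal{Z}_k$ satisfy, for all $k\ge0$, $$x_k\in\mathcal{Z}_k\subseteq\{x_0,\dots,x_k\}.$$ Let $T\ge1$. Suppose that $\mu_d(f)>0$ and that $F(x_k)-F^*\ge\delta$ for all $k$ with $1\le k\le T$. Then for $\Delta_T^*=\min_{1\le k\le T}[F(x_k)-F^*]$ and $\gamma=\frac{1}{L}\mu_d(f)$ we have $$\Delta_T^*\le\delta+\frac{(1-\gamma)^T\mu_d(f)}{1-(1-\gamma)^T}\,\beta_d(x_0,x^* )\le\delta+\frac{\mu_d(f)}{e^{\gamma T}-1}\,\beta_d(x_0,x^* )\le\delta+\frac{L}{T}\,\beta_d(x_0,x^* ).$$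
   Context: $\mathbb{E}$ is a finite-dimensional real vector space with dual $\mathbb{E}^*$; $\langle s,x\rangle$ is the value of $s\in\mathbb{E}^*$ at $x\in\mathbb{E}$ (the same notation is used for the standard inner product on $\mathbb{R}^m$). The prox-function $d$ is a closed convex function on $\mathbb{E}$, differentiable on $\operatorname{int}(\operatorname{dom} d)$, and strictly convex: $d(y) > d(x) + \langle \nabla d(x), y-x\rangle$ for all $x\in\operatorname{int}(\operatorname{dom} d)$, $y\in\operatorname{dom} d$, $x\ne y$. The Bregman distance is $\beta_d(x,y) = d(y)-d(x)-\langle\nabla d(x),y-x\rangle$ for $x\in\operatorname{int}(\operatorname{dom} d)$, $y \in \operatorname{dom} d$. $f$ is a differentiable closed convex function with open domain $\operatorname{dom} f\subseteq\operatorname{dom} d$, and $L_d(f)\ge\mu_d(f)\ge 0$ are constants such that for all $x,y\in\operatorname{dom} f$ $$\mu_d(f)\,\beta_d(x,y) \le f(y)-f(x)-\langle\nabla f(x),y-x\rangle \le L_d(f)\,\beta_d(x,y).$$ $\psi:\mathbb{E}\to\mathbb{R}\cup\{+\infty\}$ is a proper closed convex function with $\operatorname{dom}\psi\subseteq\operatorname{dom} f$ and $\operatorname{int}(\operatorname{dom}\psi)\neq\emptyset$. $F = f+\psi$, and the problem $\min_{x\in\operatorname{dom}\psi}F(x)$ is assumed to have a solution $x^*\in\operatorname{dom}\psi$, with $F^*=F(x^* )$. Standing assumption: for every $L>0$ and every $s\in\mathbb{E}^*$ the maximum $$\Phi_L(s)=\max_{y\in\operatorname{dom}\psi}\{\langle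 s,y\rangle - L d(y)-\psi(y)\}$$ is well defined (attained); its maximizer, unique by strict concavity, is denoted $y^*_L(s)$. The function $\Phi_L$ is differentiable with $\nabla\Phi_L(s)=y^*_L(s)$. One inexact iteration: given a point $\bar x\in \operatorname{dom}\psi$ (note that $\nabla d(\bar x)$ exists, since $\operatorname{dom}\psi\subseteq\operatorname{dom} f\subseteq\operatorname{int}(\operatorname{dom} d)$), a finite set $\mathcal{Z}=\{z_1,\dots,z_m\}\subseteq\operatorname{dom}\psi$ containing $\bar x$, $L>0$ and $\delta\ge0$, put $f_i=f(z_i)$, $g_i=\nabla f(z_i)$, $G\lambda=\sum_{i=1}^m\lambda^{(i)}g_i$ for $\lambda\in\mathbb{R}^m$, $f_*\in\mathbb{R}^m$ with $f_*^{(i)}=\langle g_i,z_i\rangle-f_i$, let $\Delta_m$ be the standard simplex in $\mathbb{R}^m$, and $$\xi_L(\lambda)=\Phi_L(L\nabla d(\bar x)-G\lambda)+\langle\lambda,f_*\rangle+\alpha,\qquad \alpha=L[d(\bar x)-\langle\nabla d(\bar x),\bar x\rangle].$$ Choose any $\bar\lambda\in\Delta_m$ with $\langle\bar\lambda-\lambda,\nabla\xi_L(\bar\lambda)\rangle\le\delta$ for all $\lambda\in\Delta_m$, and output $x_{\delta,L}(\bar x,\mathcal{Z}):=y^*_L(L\nabla d(\bar x)-G\bar\lambda)$. Inexact Gradient Method with Memory (IGMM): starting from $x_0$, for each $k\ge0$ choose a finite set $\mathcal{Z}_k\subseteq\operatorname{dom}\psi$ containing $x_k$, and set $x_{k+1}=x_{\delta,L}(x_k,\mathcal{Z}_k)$.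 *)

theory Defs
  imports "HOL-Analysis.Analysis"
begin

text \<open>
  An extended-valued convex function with values in the reals and plus infinity is represented
  by its effective domain \<open>D\<close> together with a real function whose values matter only on \<open>D\<close>.
  Closedness means closedness of the epigraph. The dual of \<open>'a\<close> is \<open>'a \<Rightarrow>\<^sub>L real\<close>, so no
  identification of the space with its dual is made.
\<close>

definition closed_convex_fun :: "'a::euclidean_space set \<Rightarrow> ('a \<Rightarrow> real) \<Rightarrow> bool" where
  "closed_convex_fun D f \<longleftrightarrow> convex_on D f \<and> closed (epigraph D f)"

definition grad :: "('a::euclidean_space \<Rightarrow> real) \<Rightarrow> 'a \<Rightarrow> 'a \<Rightarrow>\<^sub>L real" where
  "grad f x = Blinfun (frechet_derivative f (at x))"

definition bregman :: "('a::euclidean_space \<Rightarrow> real) \<Rightarrow> 'a \<Rightarrow> 'a \<Rightarrow> real" where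
  "bregman d x y = d y - d x - blinfun_apply (grad d x) (y - x)"

definition dual_objective ::
  "('a::euclidean_space \<Rightarrow> real) \<Rightarrow> ('a \<Rightarrow> real) \<Rightarrow> real \<Rightarrow> ('a \<Rightarrow>\<^sub>L real) \<Rightarrow> 'a \<Rightarrow> real" where
  "dual_objective d psi L s y = blinfun_apply s y - L * d y - psi y"

text \<open>The real supremum below is a maximum as soon as the objective attains its maximum on the
  domain \<open>D\<close> of \<open>psi\<close>.\<close>

definition Phi ::
  "('a::euclidean_space \<Rightarrow> real) \<Rightarrow> 'a set \<Rightarrow> ('a \<Rightarrow> real) \<Rightarrow> real \<Rightarrow> ('a \<Rightarrow>\<^sub>L real) \<Rightarrow> real" where
  "Phi d D psi L s = (SUP y\<in>D. dual_objective d psi L s y)"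

definition ystar ::
  "('a::euclidean_space \<Rightarrow> real) \<Rightarrow> 'a set \<Rightarrow> ('a \<Rightarrow> real) \<Rightarrow> real \<Rightarrow> ('a \<Rightarrow>\<^sub>L real) \<Rightarrow> 'a" where
  "ystar d D psi L s = arg_max_on (dual_objective d psi L s) D"

text \<open>A vector of \<open>\<real>\<^sup>m\<close> is a function on \<open>nat\<close> of which only the entries below \<open>m\<close> matter, because
  \<open>m\<close> varies along the iterations. A finite set \<open>{z\<^sub>1, \<dots>, z\<^sub>m}\<close> is enumerated by a list.
  The gradient on \<open>\<real>\<^sup>m\<close> is the vector of partial derivatives.\<close>

definition std_simplex :: "nat \<Rightarrow> (nat \<Rightarrow> real) set" where
  "std_simplex m = {lam. (\<forall>i<m. 0 \<le> lam i) \<and> (\<forall>i\<ge>m. lam i = 0) \<and> (\<Sum>i<m. lam i) = 1}"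

definition inner_upto :: "nat \<Rightarrow> (nat \<Rightarrow> real) \<Rightarrow> (nat \<Rightarrow> real) \<Rightarrow> real" where
  "inner_upto m u v = (\<Sum>i<m. u i * v i)"

definition grad_coord :: "((nat \<Rightarrow> real) \<Rightarrow> real) \<Rightarrow> (nat \<Rightarrow> real) \<Rightarrow> nat \<Rightarrow> real" where
  "grad_coord h lam i = deriv (\<lambda>t. h (lam(i := t))) (lam i)"

definition G_map ::
  "('a::euclidean_space \<Rightarrow> real) \<Rightarrow> 'a list \<Rightarrow> (nat \<Rightarrow> real) \<Rightarrow> 'a \<Rightarrow>\<^sub>L real" where
  "G_map f zs lam = (\<Sum>i<length zs. lam i *\<^sub>R grad f (zs ! i))"

definition f_star :: "('a::euclidean_space \<Rightarrow> real) \<Rightarrow> 'a list \<Rightarrow> nat \<Rightarrow> real" where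
  "f_star f zs i = blinfun_apply (grad f (zs ! i)) (zs ! i) - f (zs ! i)"

definition xi ::
  "('a::euclidean_space \<Rightarrow> real) \<Rightarrow> ('a \<Rightarrow> real) \<Rightarrow> 'a set \<Rightarrow> ('a \<Rightarrow> real) \<Rightarrow> real \<Rightarrow>
    'a \<Rightarrow> 'a list \<Rightarrow> (nat \<Rightarrow> real) \<Rightarrow> real" where
  "xi d f D psi L xbar zs lam =
     Phi d D psi L (L *\<^sub>R grad d xbar - G_map f zs lam)
     + inner_upto (length zs) lam (f_star f zs)
     + L * (d xbar - blinfun_apply (grad d xbar) xbar)"

text \<open>The relation \<open>inexact_step d f D psi L \<delta> xbar Z x\<close> says that \<open>x\<close> is a possible output of one
  inexact iteration at \<open>xbar\<close> with the finite set \<open>Z\<close>: the iteration is nondeterministic in the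
  choice of \<open>lam\<close>. The enumeration \<open>zs\<close> of \<open>Z\<close> may contain repetitions.\<close>

definition inexact_step ::
  "('a::euclidean_space \<Rightarrow> real) \<Rightarrow> ('a \<Rightarrow> real) \<Rightarrow> 'a set \<Rightarrow> ('a \<Rightarrow> real) \<Rightarrow> real \<Rightarrow> real \<Rightarrow>
    'a \<Rightarrow> 'a set \<Rightarrow> 'a \<Rightarrow> bool" where
  "inexact_step d f D psi L \<delta> xbar Z x \<longleftrightarrow>
     (\<exists>zs lam. set zs = Z \<and> lam \<in> std_simplex (length zs) \<and>
        (\<forall>lam'\<in>std_simplex (length zs).
           inner_upto (length zs) (\<lambda>i. lam i - lam' i)
             (grad_coord (xi d f D psi L xbar zs) lam) \<le> \<delta>) \<and>
        x = ystar d D psi L (L *\<^sub>R grad d xbar - G_map f zs lam))"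

definition IGMM ::
  "('a::euclidean_space \<Rightarrow> real) \<Rightarrow> ('a \<Rightarrow> real) \<Rightarrow> 'a set \<Rightarrow> ('a \<Rightarrow> real) \<Rightarrow> real \<Rightarrow> real \<Rightarrow>
    (nat \<Rightarrow> 'a set) \<Rightarrow> (nat \<Rightarrow> 'a) \<Rightarrow> bool" where
  "IGMM d f D psi L \<delta> Z x \<longleftrightarrow>
     (\<forall>k. finite (Z k) \<and> Z k \<subseteq> D \<and> x k \<in> Z k \<and>
          inexact_step d f D psi L \<delta> (x k) (Z k) (x (Suc k)))"

end

theory Submission
  imports Defs
begin

text \<open>
  Write \<open>\<ell>\<^sub>i\<close> for the linearization of \<open>f\<close> at \<open>z\<^sub>i\<close>. One iteration moves from \<open>xbar\<close> to the
  minimizer \<open>y\<close> over \<open>dom psi\<close> of \<open>\<Sum>\<^sub>i lam\<^sub>i \<ell>\<^sub>i + L \<beta>(xbar, \<cdot>) + psi\<close>, the linear model being an average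
  of cuts. The partial derivative of \<open>xi\<close> in \<open>lam\<^sub>i\<close> is \<open>- \<ell>\<^sub>i(y)\<close>, so testing the
  \<open>\<delta>\<close>-optimality of \<open>lam\<close> against the vertices of the simplex says that the averaged model at \<open>y\<close>
  falls short of the best single cut by at most \<open>\<delta>\<close>. Four inequalities then combine
  (\<open>inexact_step_estimate\<close>):
  relative smoothness bounds \<open>f y\<close> by the cut at \<open>xbar\<close> plus \<open>L \<beta>(xbar, y)\<close>; this cut is at most the
  model plus \<open>\<delta>\<close>; minimality of \<open>y\<close> in the model problem leaves a surplus \<open>L \<beta>(y, u)\<close>
  at any competitor \<open>u\<close> (\<open>prox_inequality\<close>); and relative strong convexity places the model at \<open>u\<close>
  below \<open>f u\<close> by the average of the \<open>mu \<beta>(z\<^sub>i, u)\<close>.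

  For \<open>u = xstar\<close> and \<open>b\<^sub>k = \<beta>(x\<^sub>k, xstar)\<close> the gap hypothesis makes \<open>b\<close> nonincreasing up to time \<open>T\<close>.
  Every remembered point is an earlier iterate, hence is at least as far from \<open>xstar\<close> as \<open>x\<^sub>k\<close>, and
  the average of the \<open>\<beta>(z\<^sub>i, xstar)\<close> may be replaced by \<open>b\<^sub>k\<close>. This yields
  \<open>b\<^sub>k\<^sub>+\<^sub>1 \<le> (1 - \<gamma>) b\<^sub>k - (\<Delta> - \<delta>) / L\<close>; unrolling it and using \<open>b\<^sub>T \<ge> 0\<close> gives the first bound. The other two
  are \<open>1 - \<gamma> \<le> exp (- \<gamma>)\<close> and \<open>exp t \<ge> 1 + t\<close>.

  The analytic part is the differentiability of the dual function \<open>Phi\<close> (\<open>Phi_has_derivative\<close>), on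
  which the formula for the partial derivatives rests. As a supremum of affine functions of \<open>s\<close>,
  \<open>Phi\<close> has the subgradient \<open>ystar s\<close> at \<open>s\<close>, and it is differentiable because \<open>ystar\<close> is continuous:
  maximizers stay bounded (\<open>bounded_maximizers\<close>), their limit points are maximizers since the
  penalty has a closed epigraph, and the maximizer is unique by strict convexity of \<open>d\<close>.
\<close>

section \<open>Closed epigraphs and gradients\<close>

lemma has_derivative_grad:
  assumes "h differentiable (at x)"
  shows "(h has_derivative blinfun_apply (grad h x)) (at x)"
proof -
  have D: "(h has_derivative frechet_derivative h (at x)) (at x)"
    using assms by (simp add: frechet_derivative_works)
  then have "blinfun_apply (grad h x) = frechet_derivative h (at x)"
    unfolding grad_def by (intro bounded_linear_Blinfun_apply has_derivative_bounded_linear)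
  with D show ?thesis by simp
qed

text \<open>
  Sequential lower semicontinuity on the whole space: outside \<open>A\<close> the function counts as plus
  infinity, so along a sequence leaving \<open>A\<close> in the limit the values of \<open>g\<close> eventually exceed every \<open>c\<close>.
\<close>

lemma closed_epigraph_eventually_gt:
  fixes g :: "'b::topological_space \<Rightarrow> real"
  assumes cl: "closed (epigraph A g)" and y: "y \<longlonglongrightarrow> l" and yA: "\<And>n. y n \<in> A"
    and c: "\<not> (l \<in> A \<and> g l \<le> c)"
  shows "eventually (\<lambda>n. c < g (y n)) sequentially"
proof -
  have "((\<lambda>n. (y n, c)) \<longlonglongrightarrow> (l, c))" by (intro tendsto_intros y)
  moreover have "open (- epigraph A g)" "(l, c) \<in> - epigraph A g"
    using cl c by (auto simp: epigraph_def)
  ultimately have "eventually (\<lambda>n. (y n, c) \<in> - epigraph A g) sequentially"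
    by (rule topological_tendstoD)
  then show ?thesis
    by eventually_elim (use yA in \<open>auto simp: epigraph_def\<close>)
qed

lemma closed_epigraph_bounded_below:
  fixes g :: "'b::topological_space \<Rightarrow> real"
  assumes "closed (epigraph A g)" "y \<longlonglongrightarrow> l" "\<And>n. y n \<in> A"
  obtains c where "eventually (\<lambda>n. c < g (y n)) sequentially"
  using closed_epigraph_eventually_gt[OF assms, of "g l - 1"] by auto

text \<open>
  Lower semicontinuity of a sum. Along a sequence converging to a point outside \<open>A\<close> the first
  summand exceeds every bound while the second stays bounded below, so the sum cannot stay below a
  convergent sequence; hence the limit lies in both domains.
\<close>

lemma closed_epigraph_add:
  fixes g h :: "'b::metric_space \<Rightarrow> real"
  assumes clg: "closed (epigraph A g)" and clh: "closed (epigraph B h)"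
  shows "closed (epigraph (A \<inter> B) (\<lambda>y. g y + h y))"
  unfolding closed_sequential_limits
proof (intro allI impI, elim conjE)
  fix w :: "nat \<Rightarrow> 'b \<times> real" and l
  assume w: "\<forall>n. w n \<in> epigraph (A \<inter> B) (\<lambda>y. g y + h y)" and lim: "w \<longlonglongrightarrow> l"
  define y where "y n = fst (w n)" for n
  define r where "r n = snd (w n)" for n
  have y: "y \<longlonglongrightarrow> fst l" and r: "r \<longlonglongrightarrow> snd l"
    unfolding y_def r_def by (intro tendsto_intros lim)+
  have yA: "y n \<in> A" and yB: "y n \<in> B" and le: "g (y n) + h (y n) \<le> r n" for n
    using w by (auto simp: y_def r_def epigraph_def)
  have key: "a + b \<le> snd l"
    if "eventually (\<lambda>n. a < g (y n)) sequentially" "eventually (\<lambda>n. b < h (y n)) sequentially"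
    for a b
  proof (rule tendsto_lowerbound[OF r])
    show "eventually (\<lambda>n. a + b \<le> r n) sequentially"
      using that by eventually_elim (use le in \<open>smt (verit)\<close>)
  qed simp
  obtain cg where cg: "eventually (\<lambda>n. cg < g (y n)) sequentially"
    by (rule closed_epigraph_bounded_below[OF clg y yA])
  obtain ch where ch: "eventually (\<lambda>n. ch < h (y n)) sequentially"
    by (rule closed_epigraph_bounded_below[OF clh y yB])
  have A: "fst l \<in> A"
    using key[OF closed_epigraph_eventually_gt[OF clg y yA, of "snd l - ch + 1"] ch] by auto
  have B: "fst l \<in> B"
    using key[OF cg closed_epigraph_eventually_gt[OF clh y yB, of "snd l - cg + 1"]] by auto
  have "g (fst l) + h (fst l) \<le> snd l"
  proof (rule field_le_epsilon)
    fix e :: real assume e: "e > 0"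
    have "(g (fst l) - e/2) + (h (fst l) - e/2) \<le> snd l"
      by (rule key) (use e in \<open>auto intro!: closed_epigraph_eventually_gt[OF clg y yA]
        closed_epigraph_eventually_gt[OF clh y yB]\<close>)
    then show "g (fst l) + h (fst l) \<le> snd l + e" by simp
  qed
  with A B show "l \<in> epigraph (A \<inter> B) (\<lambda>y. g y + h y)" by (auto simp: epigraph_def)
qed

lemma closed_epigraph_scale:
  fixes g :: "'b::topological_space \<Rightarrow> real"
  assumes "closed (epigraph A g)" "0 < c"
  shows "closed (epigraph A (\<lambda>y. c * g y))"
proof -
  have "epigraph A (\<lambda>y. c * g y) = (\<lambda>w. (fst w, snd w / c)) -` epigraph A g"
    using assms(2) by (auto simp: epigraph_def field_simps)
  moreover have "closed ((\<lambda>w. (fst w, snd w / c)) -` epigraph A g)"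
    by (rule closed_vimage[OF assms(1)]) (intro continuous_intros; use assms(2) in simp)
  ultimately show ?thesis by simp
qed

section \<open>The dual function and its maximizer\<close>

text \<open>
  The part of the setting that concerns the subproblem alone: \<open>D\<close> is the domain of \<open>psi\<close> and the
  parameter \<open>L\<close> is fixed. Iterates and competitors all lie in \<open>D\<close>, so the tangents of \<open>d\<close> are taken
  at points of \<open>D\<close>.
\<close>

locale regularised_dual =
  fixes d psi :: "'a::euclidean_space \<Rightarrow> real" and dom_d D :: "'a set" and L :: real
  assumes d_closed: "closed (epigraph dom_d d)"
    and D_sub: "D \<subseteq> dom_d"
    and d_diff: "\<And>y. y \<in> D \<Longrightarrow> d differentiable (at y)"
    and d_strict: "\<And>y z. y \<in> D \<Longrightarrow> z \<in> D \<Longrightarrow> y \<noteq> z \<Longrightarrow>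
      d y + blinfun_apply (grad d y) (z - y) < d z"
    and psi_convex: "convex_on D psi"
    and psi_closed: "closed (epigraph D psi)"
    and L_pos: "0 < L"
    and attained: "\<And>s. \<exists>y. is_arg_max (dual_objective d psi L s) (\<lambda>y. y \<in> D) y"
begin

abbreviation "obj \<equiv> dual_objective d psi L"
abbreviation "Y \<equiv> ystar d D psi L"
abbreviation "\<Phi> \<equiv> Phi d D psi L"

lemma bregman_nonneg:
  assumes "y \<in> D" "z \<in> D" shows "0 \<le> bregman d y z"
  using d_strict[OF assms] by (cases "y = z") (auto simp: bregman_def)

lemma Y_in: "Y s \<in> D" and Y_max: "y \<in> D \<Longrightarrow> obj s y \<le> obj s (Y s)"
proof -
  have "is_arg_max (obj s) (\<lambda>y. y \<in> D) (Y s)"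
    unfolding ystar_def arg_max_on_def arg_max_def by (rule someI_ex[OF attained])
  then show "Y s \<in> D" "y \<in> D \<Longrightarrow> obj s y \<le> obj s (Y s)"
    by (auto simp: is_arg_max_linorder)
qed

lemma Phi_eq: "\<Phi> s = obj s (Y s)"
  unfolding Phi_def by (rule cSup_eq_maximum) (auto intro: Y_in Y_max)

lemma obj_le_Phi: "y \<in> D \<Longrightarrow> obj s y \<le> \<Phi> s"
  by (simp add: Phi_eq Y_max)

text \<open>
  The objective at the midpoint of two distinct maximizers would be larger: the tangent of \<open>d\<close> at the
  midpoint lies strictly below \<open>d\<close> at both ends.
\<close>

lemma maximizer_unique:
  assumes z: "z \<in> D" and ge: "obj s (Y s) \<le> obj s z"
  shows "z = Y s"
proof (rule ccontr)
  assume ne: "z \<noteq> Y s"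
  define y where "y = Y s"
  define m where "m = (1/2) *\<^sub>R y + (1/2) *\<^sub>R z"
  have yD: "y \<in> D" by (simp add: y_def Y_in)
  have cv: "convex D" using psi_convex by (simp add: convex_on_def)
  have mD: "m \<in> D" unfolding m_def by (rule convexD[OF cv yD z]) auto
  have psim: "psi m \<le> psi y / 2 + psi z / 2"
    using convex_onD[OF psi_convex, of "1/2" y z] yD z by (simp add: m_def)
  have ym: "y - m = (1/2) *\<^sub>R (y - z)" and zm: "z - m = - ((1/2) *\<^sub>R (y - z))"
    by (simp_all add: m_def algebra_simps flip: scaleR_add_left)
  have "m \<noteq> y" "m \<noteq> z" using ym zm ne by (auto simp: y_def)
  then have "d m < (d y + d z) / 2"
    using d_strict[OF mD yD] d_strict[OF mD z] by (simp add: ym zm blinfun.minus_right)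
  then have "L * d m < L * ((d y + d z) / 2)" using L_pos by simp
  moreover have "blinfun_apply s m = (blinfun_apply s y + blinfun_apply s z) / 2"
    by (simp add: m_def blinfun.add_right blinfun.scaleR_right)
  ultimately have "obj s y < obj s m"
    using psim ge by (simp add: dual_objective_def y_def[symmetric] field_simps)
  with Y_max[OF mD, of s] show False by (simp add: y_def)
qed

lemma obj_add: "obj (s + h) y = obj s y + blinfun_apply h y"
  by (simp add: dual_objective_def blinfun.add_left)

lemma obj_diff: "obj (s - h) y = obj s y - blinfun_apply h y"
  by (simp add: dual_objective_def blinfun.diff_left)

text \<open>
  Attainment of the maximum for every \<open>s\<close> forces coercivity: perturbing \<open>s\<close> by plus and minus
  \<open>DIM('a)\<close> times a coordinate functional bounds the objective plus \<open>DIM('a)\<close> times the modulus of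
  that coordinate, and averaging over the coordinates produces the 1-norm.
\<close>

lemma obj_coercive: "\<exists>C. \<forall>y\<in>D. obj s y + norm y \<le> C"
proof -
  define n where "n = real DIM('a)"
  define h where "h b = blinfun_scaleR_left (n::real) o\<^sub>L blinfun_inner_left b" for b :: 'a
  define C where "C b = max (\<Phi> (s + h b)) (\<Phi> (s - h b))" for b
  have n: "n > 0" by (simp add: n_def)
  have hb: "blinfun_apply (h b) y = n * (y \<bullet> b)" for b y
    by (simp add: h_def mult.commute inner_commute)
  have b: "obj s y + n * \<bar>y \<bullet> b\<bar> \<le> C b" if "y \<in> D" for y b
    using obj_le_Phi[OF that, of "s + h b"] obj_le_Phi[OF that, of "s - h b"]
    by (auto simp: C_def obj_add obj_diff hb abs_if)
  have "obj s y + norm y \<le> (\<Sum>b\<in>Basis. C b) / n" if "y \<in> D" for y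
  proof -
    have "n * (obj s y + norm y) \<le> n * (obj s y + (\<Sum>b\<in>Basis. \<bar>y \<bullet> b\<bar>))"
      using n norm_le_l1[of y] by simp
    also have "\<dots> = (\<Sum>b\<in>Basis. obj s y + n * \<bar>y \<bullet> b\<bar>)"
      by (simp add: sum.distrib n_def sum_distrib_left algebra_simps)
    also have "\<dots> \<le> (\<Sum>b\<in>Basis. C b)" by (intro sum_mono b that)
    finally show ?thesis using n by (simp add: field_simps)
  qed
  then show ?thesis by blast
qed

lemma closed_epigraph_penalty: "closed (epigraph D (\<lambda>y. L * d y + psi y))"
proof -
  have "dom_d \<inter> D = D" using D_sub by auto
  then show ?thesis
    using closed_epigraph_add[OF closed_epigraph_scale[OF d_closed L_pos] psi_closed] by simp
qed

text \<open>
  A perturbation of \<open>s\<close> of norm below one half consumes at most half of the coercive term, while the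
  maximal value stays above the perturbed value at the fixed point \<open>Y s\<close>.
\<close>

lemma bounded_maximizers:
  assumes S: "S \<longlonglongrightarrow> s"
  shows "bounded (range (\<lambda>n. Y (S n)))"
proof -
  obtain C where C: "\<And>y. y \<in> D \<Longrightarrow> obj s y + norm y \<le> C" using obj_coercive by blast
  have half: "eventually (\<lambda>n. norm (S n - s) < 1/2) sequentially"
    using tendstoD[OF S, of "1/2"] by (simp add: dist_norm)
  define K where "K = obj s (Y s) - norm (Y s)"
  have "eventually (\<lambda>n. norm (Y (S n)) \<le> 2 * (C - K)) sequentially"
    using half
  proof eventually_elim
    case (elim n)
    let ?h = "S n - s"
    have "\<bar>blinfun_apply ?h y\<bar> \<le> norm y / 2" for y
      using order_trans[OF norm_blinfun[of ?h y] mult_right_mono[of "norm ?h" "1/2" "norm y"]] elim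
      by simp
    note this[of "Y s"] this[of "Y (S n)"]
    moreover have "obj (S n) y = obj s y + blinfun_apply ?h y" for y
      using obj_add[of s ?h y] by simp
    moreover note Y_max[OF Y_in[of s], of "S n"] C[OF Y_in[of "S n"]]
    ultimately show ?case unfolding K_def by (smt (verit) field_sum_of_halves norm_ge_zero)
  qed
  then obtain N where N: "\<And>n. n \<ge> N \<Longrightarrow> norm (Y (S n)) \<le> 2 * (C - K)"
    by (auto simp: eventually_sequentially)
  have "range (\<lambda>n. Y (S n)) \<subseteq> (\<lambda>n. Y (S n)) ` {..<N} \<union> cball 0 (2 * (C - K))"
  proof (rule image_subsetI)
    show "Y (S n) \<in> (\<lambda>n. Y (S n)) ` {..<N} \<union> cball 0 (2 * (C - K))" for n
      using N[of n] by (cases "n < N") auto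
  qed
  then show ?thesis
    by (rule bounded_subset[rotated]) (auto intro: finite_imp_bounded)
qed

text \<open>
  Compactness: a subsequence staying away from \<open>Y s\<close> would have a limit point \<open>l\<close>, which is a
  maximizer at \<open>s\<close> because the inequalities saying that each \<open>Y (S n)\<close> does at least as well as \<open>Y s\<close> at
  \<open>S n\<close> amount to membership in a closed epigraph.
\<close>

lemma maximizer_tendsto:
  assumes S: "S \<longlonglongrightarrow> s"
  shows "(\<lambda>n. Y (S n)) \<longlonglongrightarrow> Y s"
proof (rule ccontr)
  assume "\<not> (\<lambda>n. Y (S n)) \<longlonglongrightarrow> Y s"
  then obtain e where e: "e > 0" and "\<not> eventually (\<lambda>n. dist (Y (S n)) (Y s) < e) sequentially"
    unfolding tendsto_iff by blast
  then have "\<exists>\<^sub>F n in sequentially. \<not> dist (Y (S n)) (Y s) < e" by (simp add: frequently_def)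
  then have "infinite {n. \<not> dist (Y (S n)) (Y s) < e}"
    by (simp add: frequently_cofinite flip: cofinite_eq_sequentially)
  then obtain r0 :: "nat \<Rightarrow> nat" where r0: "strict_mono r0"
    and far: "\<And>n. \<not> dist (Y (S (r0 n))) (Y s) < e"
    using infinite_enumerate by blast
  have "bounded (range (\<lambda>n. Y (S (r0 n))))"
    by (rule bounded_subset[OF bounded_maximizers[OF S]]) auto
  then obtain l r1 where r1: "strict_mono r1" and l: "((\<lambda>n. Y (S (r0 n))) \<circ> r1) \<longlonglongrightarrow> l"
    using bounded_imp_convergent_subsequence by blast
  define r where "r = r0 \<circ> r1"
  have yl: "(\<lambda>n. Y (S (r n))) \<longlonglongrightarrow> l" using l by (simp add: r_def o_def)
  have Sr: "(\<lambda>n. S (r n)) \<longlonglongrightarrow> s"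
    using LIMSEQ_subseq_LIMSEQ[OF S, of r] r0 r1 strict_mono_o by (auto simp: r_def o_def)
  \<comment> \<open>\<open>v n\<close> is the largest penalty with which \<open>Y (S (r n))\<close> would still do as well as \<open>Y s\<close> at
    \<open>S (r n)\<close>. It bounds the actual penalty from above, and its limit is known.\<close>
  define v where "v n = blinfun_apply (S (r n)) (Y (S (r n))) - obj (S (r n)) (Y s)" for n
  have obj_lim: "(\<lambda>n. obj (S (r n)) (Y s)) \<longlonglongrightarrow> obj s (Y s)"
    unfolding dual_objective_def by (intro tendsto_intros Sr)
  have v: "v \<longlonglongrightarrow> blinfun_apply s l - obj s (Y s)"
    unfolding v_def by (intro tendsto_intros Sr yl obj_lim)
  have epi: "(Y (S (r n)), v n) \<in> epigraph D (\<lambda>y. L * d y + psi y)" for n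
    using Y_in[of "S (r n)"] Y_max[OF Y_in[of s], of "S (r n)"]
    by (auto simp: epigraph_def v_def dual_objective_def)
  have "(l, blinfun_apply s l - obj s (Y s)) \<in> epigraph D (\<lambda>y. L * d y + psi y)"
    by (rule closed_sequentially[OF closed_epigraph_penalty epi tendsto_Pair[OF yl v]])
  then have "l \<in> D" "obj s (Y s) \<le> obj s l"
    by (auto simp: epigraph_def dual_objective_def)
  then have "l = Y s" by (rule maximizer_unique)
  then have "eventually (\<lambda>n. dist (Y (S (r n))) (Y s) < e) sequentially"
    using tendstoD[OF yl e] by simp
  then show False using far by (auto simp: r_def eventually_sequentially)
qed

lemma isCont_maximizer: "isCont Y s"
  by (rule continuous_at_sequentiallyI) (rule maximizer_tendsto)

text \<open>
  Danskin's formula. Comparing each of \<open>Y s\<close> and \<open>Y t\<close> with the other one's objective traps the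
  linearization error between zero and the value of \<open>t - s\<close> at \<open>Y t - Y s\<close>, which is of lower order by continuity
  of \<open>Y\<close>.
\<close>

lemma Phi_has_derivative: "(\<Phi> has_derivative (\<lambda>h. blinfun_apply h (Y s))) (at s)"
proof (rule has_derivativeI_sandwich[of 1])
  show "bounded_linear (\<lambda>h. blinfun_apply h (Y s))"
    by (rule blinfun.bounded_linear_left)
  show "((\<lambda>t. norm (Y t - Y s)) \<longlongrightarrow> 0) (at s)"
    using isCont_maximizer[of s] by (simp add: isCont_def LIM_zero tendsto_norm_zero)
  fix t assume ne: "t \<noteq> s"
  let ?h = "t - s"
  have t: "obj t y = obj s y + blinfun_apply ?h y" for y using obj_add[of s ?h y] by simp
  have "norm (\<Phi> t - \<Phi> s - blinfun_apply ?h (Y s)) \<le> blinfun_apply ?h (Y t - Y s)"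
    using Y_max[OF Y_in[of s], of t] Y_max[OF Y_in[of t], of s]
    by (auto simp: Phi_eq t blinfun.diff_right abs_if)
  also have "\<dots> \<le> norm ?h * norm (Y t - Y s)"
    using norm_blinfun[of ?h "Y t - Y s"] by (simp add: abs_le_iff)
  finally show "norm (\<Phi> t - \<Phi> s - blinfun_apply ?h (Y s)) / norm ?h \<le> norm (Y t - Y s)"
    using ne by (simp add: field_simps)
qed simp

lemma G_map_upd:
  "i < length zs \<Longrightarrow> G_map f zs (lam(i := t)) = G_map f zs lam + (t - lam i) *\<^sub>R grad f (zs ! i)"
  by (simp add: G_map_def sum.remove[of "{..<length zs}" i] algebra_simps)

lemma inner_upto_upd:
  "i < m \<Longrightarrow> inner_upto m (lam(i := t)) v = inner_upto m lam v + (t - lam i) * v i"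
  by (simp add: inner_upto_def sum.remove[of "{..<m}" i] algebra_simps)

text \<open>Raising the weight \<open>lam i\<close> lowers \<open>xi\<close> at the rate given by the \<open>i\<close>-th cut at the current output
  \<open>y\<close>; this is what links the stopping criterion to the quality of the model.\<close>

lemma grad_coord_xi:
  assumes i: "i < length zs" and y_def: "y = Y (L *\<^sub>R grad d xbar - G_map f zs lam)"
  shows "grad_coord (xi d f D psi L xbar zs) lam i
    = - (f (zs ! i) + blinfun_apply (grad f (zs ! i)) (y - zs ! i))"
proof -
  let ?s = "L *\<^sub>R grad d xbar - G_map f zs lam"
  let ?g = "grad f (zs ! i)"
  have "((\<lambda>t. ?s - (t - lam i) *\<^sub>R ?g) has_derivative (\<lambda>t. - (t *\<^sub>R ?g))) (at (lam i))"
    by (auto intro!: derivative_eq_intros)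
  from has_derivative_compose[OF this, of \<Phi> "\<lambda>h. blinfun_apply h y"]
  have "((\<lambda>t. \<Phi> (?s - (t - lam i) *\<^sub>R ?g)) has_derivative
      (\<lambda>t. blinfun_apply (- (t *\<^sub>R ?g)) y)) (at (lam i))"
    using Phi_has_derivative[of ?s] by (simp add: y_def)
  moreover have "(\<lambda>t. blinfun_apply (- (t *\<^sub>R ?g)) y) = (*) (- blinfun_apply ?g y)"
    by (auto simp: blinfun.minus_left blinfun.scaleR_left)
  ultimately have "((\<lambda>t. \<Phi> (?s - (t - lam i) *\<^sub>R ?g)) has_real_derivative
      - blinfun_apply ?g y) (at (lam i))"
    by (simp add: has_field_derivative_def)
  then have "((\<lambda>t. xi d f D psi L xbar zs (lam(i := t))) has_real_derivative
      - blinfun_apply ?g y + f_star f zs i) (at (lam i))"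
    unfolding xi_def G_map_upd[OF i] inner_upto_upd[OF i]
    by (auto simp: diff_diff_add intro!: derivative_eq_intros)
  then show ?thesis
    unfolding grad_coord_def by (simp add: DERIV_imp_deriv f_star_def blinfun.diff_right)
qed

text \<open>
  First-order optimality of \<open>Y s\<close>: on the segment to \<open>u\<close> the objective stays below its value at \<open>Y s\<close>,
  \<open>psi\<close> lies below its chord, and the difference quotients of \<open>d\<close> converge to the gradient term. That
  \<open>d\<close> enters through its linearization at \<open>Y s\<close> is what yields the surplus \<open>L \<beta>(Y s, u)\<close> in the step
  estimate.
\<close>

lemma prox_inequality:
  assumes u: "u \<in> D"
  shows "psi (Y s) + blinfun_apply s (u - Y s) \<le> psi u + L * blinfun_apply (grad d (Y s)) (u - Y s)"
proof -
  let ?y = "Y s"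
  let ?\<phi> = "\<lambda>t::real. d (?y + t *\<^sub>R (u - ?y))"
  define c where "c = (blinfun_apply s (u - ?y) + psi ?y - psi u) / L"
  have yD: "?y \<in> D" by (rule Y_in)
  have "(?\<phi> has_derivative (\<lambda>t. blinfun_apply (grad d ?y) (t *\<^sub>R (u - ?y)))) (at 0)"
    by (rule has_derivative_compose[of "\<lambda>t. ?y + t *\<^sub>R (u - ?y)"])
      (auto intro!: derivative_eq_intros has_derivative_grad d_diff yD)
  moreover have "(\<lambda>t. blinfun_apply (grad d ?y) (t *\<^sub>R (u - ?y)))
      = (*) (blinfun_apply (grad d ?y) (u - ?y))"
    by (auto simp: blinfun.scaleR_right)
  ultimately have "(?\<phi> has_real_derivative blinfun_apply (grad d ?y) (u - ?y)) (at 0)"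
    by (simp add: has_field_derivative_def)
  then have "((\<lambda>t. (?\<phi> t - ?\<phi> 0) / t) \<longlongrightarrow> blinfun_apply (grad d ?y) (u - ?y)) (at_right 0)"
    by (auto simp: DERIV_def intro: tendsto_mono[OF at_le[of _ UNIV]])
  moreover have "eventually (\<lambda>t. c \<le> (?\<phi> t - ?\<phi> 0) / t) (at_right 0)"
    unfolding eventually_at_right_field
  proof (intro exI[of _ 1] conjI allI impI)
    fix t :: real assume t: "0 < t" "t < 1"
    let ?w = "?y + t *\<^sub>R (u - ?y)"
    have w: "?w = (1 - t) *\<^sub>R ?y + t *\<^sub>R u" by (simp add: algebra_simps)
    have cv: "convex D" using psi_convex by (simp add: convex_on_def)
    have wD: "?w \<in> D" unfolding w by (rule convexD[OF cv yD u]) (use t in auto)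
    have "psi ?w \<le> (1 - t) * psi ?y + t * psi u"
      unfolding w by (rule convex_onD[OF psi_convex]) (use t yD u in auto)
    moreover have "blinfun_apply s ?w = blinfun_apply s ?y + t * blinfun_apply s (u - ?y)"
      by (simp add: blinfun.add_right blinfun.scaleR_right)
    ultimately have "t * (blinfun_apply s (u - ?y) + psi ?y - psi u) \<le> L * (?\<phi> t - ?\<phi> 0)"
      using Y_max[OF wD, of s] unfolding dual_objective_def right_diff_distrib distrib_left
      by simp argo
    then show "c \<le> (?\<phi> t - ?\<phi> 0) / t" using t L_pos by (simp add: c_def field_simps)
  qed simp
  ultimately have "c \<le> blinfun_apply (grad d ?y) (u - ?y)"
    by (intro tendsto_lowerbound) auto
  then show ?thesis using L_pos by (simp add: c_def field_simps)
qed

section \<open>One inexact iteration\<close>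

text \<open>
  The competitor \<open>u\<close> is arbitrary, and \<open>r\<close> is any lower bound for the distances from the remembered
  points to \<open>u\<close>: relative strong convexity enters only through the cuts evaluated at \<open>u\<close>, each of
  which is below \<open>f u\<close> by at least \<open>mu * r\<close>.
\<close>

lemma inexact_step_estimate:
  fixes f :: "'a \<Rightarrow> real"
  assumes mu: "0 \<le> mu"
    and lower: "\<And>y z. y \<in> D \<Longrightarrow> z \<in> D \<Longrightarrow>
      mu * bregman d y z \<le> f z - f y - blinfun_apply (grad f y) (z - y)"
    and upper: "\<And>y z. y \<in> D \<Longrightarrow> z \<in> D \<Longrightarrow>
      f z - f y - blinfun_apply (grad f y) (z - y) \<le> L * bregman d y z"
    and step: "inexact_step d f D psi L \<delta> xbar Z y"
    and Z: "Z \<subseteq> D" "xbar \<in> Z" and u: "u \<in> D"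
    and r: "\<And>z. z \<in> Z \<Longrightarrow> r \<le> bregman d z u"
  shows "f y + psi y + L * bregman d y u
    \<le> f u + psi u + \<delta> + L * bregman d xbar u - mu * r"
proof -
  obtain zs lam where zs: "set zs = Z" and lam: "lam \<in> std_simplex (length zs)"
    and opt: "\<And>lam'. lam' \<in> std_simplex (length zs) \<Longrightarrow>
      inner_upto (length zs) (\<lambda>i. lam i - lam' i) (grad_coord (xi d f D psi L xbar zs) lam) \<le> \<delta>"
    and y: "y = Y (L *\<^sub>R grad d xbar - G_map f zs lam)"
    using step unfolding inexact_step_def by blast
  define m where "m = length zs"
  define lin where "lin i v = f (zs ! i) + blinfun_apply (grad f (zs ! i)) (v - zs ! i)" for i v
  define model where "model v = (\<Sum>i<m. lam i * lin i v)" for v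
  have lam0: "\<And>i. i < m \<Longrightarrow> 0 \<le> lam i" and lam1: "(\<Sum>i<m. lam i) = 1"
    using lam by (auto simp: std_simplex_def m_def)
  have yD: "y \<in> D" by (simp add: y Y_in)
  have xD: "xbar \<in> D" using Z by auto
  have zD: "zs ! i \<in> Z" if "i < m" for i using that zs by (auto simp: m_def)
  have lin_le: "lin j y \<le> model y + \<delta>" if j: "j < m" for j
  proof -
    \<comment> \<open>the vertex of the simplex that puts all weight on the \<open>j\<close>-th cut\<close>
    let ?e = "(\<lambda>_. 0)(j := 1) :: nat \<Rightarrow> real"
    have "?e \<in> std_simplex (length zs)"
      using j by (auto simp: std_simplex_def m_def)
    then have "inner_upto m (\<lambda>i. lam i - ?e i) (grad_coord (xi d f D psi L xbar zs) lam) \<le> \<delta>"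
      unfolding m_def by (rule opt)
    also have "inner_upto m (\<lambda>i. lam i - ?e i) (grad_coord (xi d f D psi L xbar zs) lam)
        = (\<Sum>i<m. (if i = j then lin i y else 0) - lam i * lin i y)"
      unfolding inner_upto_def
      by (rule sum.cong) (auto simp: grad_coord_xi[OF _ y] m_def lin_def algebra_simps)
    also have "\<dots> = lin j y - model y"
      using j by (simp add: sum_subtractf model_def)
    finally show ?thesis by simp
  qed
  have smooth: "f y \<le> model y + \<delta> + L * bregman d xbar y"
  proof -
    obtain j where "j < m" "zs ! j = xbar"
      using Z(2) zs by (metis in_set_conv_nth m_def)
    then show ?thesis using lin_le[of j] upper[OF xD yD] by (simp add: lin_def)
  qed
  have model_u: "model u \<le> f u - mu * r"
  proof -
    have "lin i u \<le> f u - mu * r" if "i < m" for i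
      using lower[of "zs ! i" u] zD[OF that] Z(1) u mult_left_mono[OF r[OF zD[OF that]] mu]
      by (auto simp: lin_def)
    then have "model u \<le> (\<Sum>i<m. lam i * (f u - mu * r))"
      unfolding model_def by (intro sum_mono mult_left_mono) (auto simp: lam0)
    then show ?thesis by (simp add: lam1 flip: sum_distrib_right)
  qed
  have model_diff: "model u - model y = blinfun_apply (G_map f zs lam) (u - y)"
    unfolding model_def G_map_def m_def lin_def
    by (simp add: blinfun.sum_left blinfun.scaleR_left blinfun.diff_right algebra_simps
        flip: sum_subtractf)
  have "psi y + model y + L * bregman d xbar y + L * bregman d y u
      \<le> psi u + model u + L * bregman d xbar u"
    using prox_inequality[OF u, of "L *\<^sub>R grad d xbar - G_map f zs lam", folded y] model_diff
    by (simp add: bregman_def blinfun.diff_left blinfun.scaleR_left blinfun.diff_right algebra_simps)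
  with smooth model_u show ?thesis by simp
qed

end

section \<open>Contraction along the iterations\<close>

lemma affine_recurrence_bound:
  fixes b :: "nat \<Rightarrow> real"
  assumes q: "0 \<le> q" and step: "\<And>k. k < T \<Longrightarrow> b (Suc k) \<le> q * b k - e"
  shows "b T \<le> q ^ T * b 0 - e * (\<Sum>j<T. q ^ j)"
  using step
proof (induction T)
  case (Suc T)
  have "b (Suc T) \<le> q * b T - e" using Suc.prems by simp
  also have "\<dots> \<le> q * (q ^ T * b 0 - e * (\<Sum>j<T. q ^ j)) - e"
    using Suc q by (intro diff_right_mono mult_left_mono) auto
  also have "\<dots> = q ^ Suc T * b 0 - e * (\<Sum>j<Suc T. q ^ j)"
    by (simp add: sum.lessThan_Suc_shift sum_distrib_left algebra_simps del: sum.lessThan_Suc)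
  finally show ?case .
qed simp

text \<open>The inequality \<open>(1 - \<gamma>) ^ T \<le> exp (- \<gamma> T)\<close> carries over through the increasing map \<open>q / (1 - q)\<close>,
  which sends \<open>1 / E\<close> to \<open>1 / (E - 1)\<close>.\<close>

lemma contraction_factor_bounds:
  fixes \<gamma> :: real
  assumes g: "0 < \<gamma>" "\<gamma> \<le> 1" and T: "T \<ge> 1"
  shows "(1 - \<gamma>) ^ T < 1"
    and "(1 - \<gamma>) ^ T / (1 - (1 - \<gamma>) ^ T) \<le> 1 / (exp (\<gamma> * real T) - 1)"
    and "1 / (exp (\<gamma> * real T) - 1) \<le> 1 / (\<gamma> * real T)"
proof -
  let ?E = "exp (\<gamma> * real T)" and ?q = "(1 - \<gamma>) ^ T"
  have gT: "0 < \<gamma> * real T" using g T by simp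
  have E: "?E \<ge> 1 + \<gamma> * real T" by (rule exp_ge_add_one_self)
  have "?q \<le> exp (- \<gamma>) ^ T"
    using g exp_ge_add_one_self[of "- \<gamma>"] by (intro power_mono) auto
  also have "\<dots> = 1 / ?E" by (simp add: exp_of_nat2_mult[symmetric] exp_minus field_simps)
  finally have q: "?q \<le> 1 / ?E" .
  show q1: "?q < 1" using q gT E by (smt (verit) divide_less_eq_1_pos)
  have "?q * ?E \<le> 1" using q by (simp add: field_simps)
  then show "?q / (1 - ?q) \<le> 1 / (?E - 1)"
    using q1 gT E by (simp add: divide_simps algebra_simps)
  show "1 / (?E - 1) \<le> 1 / (\<gamma> * real T)"
  proof (rule divide_left_mono)
    show "\<gamma> * real T \<le> ?E - 1" using E by linarith
    show "0 < (?E - 1) * (\<gamma> * real T)" using gT by simp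
  qed simp
qed

theorem theorem3:
  fixes d f psi F :: "'a::euclidean_space \<Rightarrow> real"
    and dom_d dom_f dom_psi :: "'a set"
    and mu Ld L \<delta> \<gamma> \<Delta> :: real
    and x :: "nat \<Rightarrow> 'a" and xstar :: 'a
    and Z :: "nat \<Rightarrow> 'a set" and T :: nat
  assumes d_closed_convex: "closed_convex_fun dom_d d"
    and d_differentiable: "\<And>y. y \<in> interior dom_d \<Longrightarrow> d differentiable (at y)"
    and d_strictly_convex:
      "\<And>y z. y \<in> interior dom_d \<Longrightarrow> z \<in> dom_d \<Longrightarrow> y \<noteq> z \<Longrightarrow>
         d z > d y + blinfun_apply (grad d y) (z - y)"
    and f_closed_convex: "closed_convex_fun dom_f f"
    and f_open: "open dom_f"
    and f_dom: "dom_f \<subseteq> dom_d"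
    and f_differentiable: "\<And>y. y \<in> dom_f \<Longrightarrow> f differentiable (at y)"
    and mu_Ld: "0 \<le> mu" "mu \<le> Ld"
    and relative_strong_convexity:
      "\<And>y z. y \<in> dom_f \<Longrightarrow> z \<in> dom_f \<Longrightarrow>
         mu * bregman d y z \<le> f z - f y - blinfun_apply (grad f y) (z - y)"
    and relative_smoothness:
      "\<And>y z. y \<in> dom_f \<Longrightarrow> z \<in> dom_f \<Longrightarrow>
         f z - f y - blinfun_apply (grad f y) (z - y) \<le> Ld * bregman d y z"
    and psi_closed_convex: "closed_convex_fun dom_psi psi"
    and psi_dom: "dom_psi \<subseteq> dom_f"
    and psi_interior: "interior dom_psi \<noteq> {}"
    and F_eq: "F = (\<lambda>y. f y + psi y)"
    and xstar_dom: "xstar \<in> dom_psi"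
    and xstar_min: "\<And>y. y \<in> dom_psi \<Longrightarrow> F xstar \<le> F y"
    and max_attained:
      "\<And>M s. M > 0 \<Longrightarrow> \<exists>y. is_arg_max (dual_objective d psi M s) (\<lambda>y. y \<in> dom_psi) y"
    and x0: "x 0 \<in> interior dom_psi"
    and delta: "\<delta> \<ge> 0"
    and L: "L > 0" "L \<ge> Ld"
    and igmm: "IGMM d f dom_psi psi L \<delta> Z x"
    and Z_memory: "\<And>k. x k \<in> Z k \<and> Z k \<subseteq> x ` {0..k}"
    and T: "T \<ge> 1"
    and mu_pos: "mu > 0"
    and gap: "\<And>k. 1 \<le> k \<Longrightarrow> k \<le> T \<Longrightarrow> F (x k) - F xstar \<ge> \<delta>"
    and Delta_eq: "\<Delta> = Min ((\<lambda>k. F (x k) - F xstar) ` {1..T})"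
    and gamma_eq: "\<gamma> = 1 / L * mu"
  shows "\<Delta> \<le> \<delta> + (1 - \<gamma>) ^ T * mu / (1 - (1 - \<gamma>) ^ T) * bregman d (x 0) xstar
    \<and> \<delta> + (1 - \<gamma>) ^ T * mu / (1 - (1 - \<gamma>) ^ T) * bregman d (x 0) xstar
        \<le> \<delta> + mu / (exp (\<gamma> * real T) - 1) * bregman d (x 0) xstar
    \<and> \<delta> + mu / (exp (\<gamma> * real T) - 1) * bregman d (x 0) xstar
        \<le> \<delta> + L / real T * bregman d (x 0) xstar"
proof -
  have D_int: "dom_psi \<subseteq> interior dom_d"
    using psi_dom interior_maximal[OF f_dom f_open] by blast
  have D_d: "dom_psi \<subseteq> dom_d" using psi_dom f_dom by blast
  interpret regularised_dual d psi dom_d dom_psi L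
  proof
    show "closed (epigraph dom_d d)" using d_closed_convex by (simp add: closed_convex_fun_def)
    show "dom_psi \<subseteq> dom_d" by (rule D_d)
    show "d differentiable (at y)" if "y \<in> dom_psi" for y
      using that D_int d_differentiable by blast
    show "d y + blinfun_apply (grad d y) (z - y) < d z"
      if "y \<in> dom_psi" "z \<in> dom_psi" "y \<noteq> z" for y z
      using that D_int D_d d_strictly_convex by blast
    show "convex_on dom_psi psi" "closed (epigraph dom_psi psi)"
      using psi_closed_convex by (simp_all add: closed_convex_fun_def)
    show "0 < L" by (rule L(1))
    show "\<exists>y. is_arg_max (dual_objective d psi L s) (\<lambda>y. y \<in> dom_psi) y" for s
      by (rule max_attained[OF L(1)])
  qed
  define b where "b k = bregman d (x k) xstar" for k
  have xD: "x k \<in> dom_psi" for k using igmm unfolding IGMM_def by blast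
  have b0: "0 \<le> b k" for k unfolding b_def by (rule bregman_nonneg[OF xD xstar_dom])
  have lower: "mu * bregman d y z \<le> f z - f y - blinfun_apply (grad f y) (z - y)"
    if "y \<in> dom_psi" "z \<in> dom_psi" for y z
    using that psi_dom by (intro relative_strong_convexity) auto
  have upper: "f z - f y - blinfun_apply (grad f y) (z - y) \<le> L * bregman d y z"
    if "y \<in> dom_psi" "z \<in> dom_psi" for y z
    using relative_smoothness[of y z] psi_dom that
      mult_right_mono[OF L(2) bregman_nonneg[OF that]] by (meson order_trans subsetD)
  have step: "F (x (Suc k)) - F xstar - \<delta> + L * b (Suc k) \<le> L * b k - mu * b k"
    if closest: "\<forall>j\<le>k. b k \<le> b j" for k
  proof -
    have "b k \<le> bregman d z xstar" if "z \<in> Z k" for z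
      using that Z_memory[of k] closest by (auto simp: b_def)
    then show ?thesis
      using inexact_step_estimate[OF mu_Ld(1) lower upper, of \<delta> "x k" "Z k" "x (Suc k)" xstar "b k"]
        igmm xstar_dom by (auto simp: IGMM_def F_eq b_def)
  qed
  \<comment> \<open>By induction the distances to \<open>xstar\<close> do not increase: if \<open>x k\<close> is the closest iterate so far, the step
    estimate applies with \<open>r = b k\<close>, and the gap being at least \<open>\<delta>\<close> makes \<open>x (Suc k)\<close> at least as close.\<close>
  have closest: "\<forall>j\<le>k. b k \<le> b j" if "k \<le> T" for k
    using that
  proof (induction k)
    case (Suc k)
    then have IH: "\<forall>j\<le>k. b k \<le> b j" by simp
    have "0 \<le> mu * b k" using b0 mu_pos by simp
    then have "L * b (Suc k) \<le> L * b k" using step[OF IH] gap[of "Suc k"] Suc.prems by simp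
    then have "b (Suc k) \<le> b k" using L(1) by simp
    then show ?case using IH by (auto simp: le_Suc_eq intro: order_trans)
  qed simp
  have g: "0 < \<gamma>" "\<gamma> \<le> 1" using mu_pos mu_Ld L by (auto simp: gamma_eq)
  let ?q = "(1 - \<gamma>) ^ T"
  note bounds = contraction_factor_bounds[OF g T]
  have Delta_le: "\<Delta> \<le> F (x k) - F xstar" if "1 \<le> k" "k \<le> T" for k
    unfolding Delta_eq by (rule Min_le) (use that in auto)
  have "b T \<le> ?q * b 0 - (\<Delta> - \<delta>) / L * (\<Sum>j<T. (1 - \<gamma>) ^ j)"
  proof (rule affine_recurrence_bound)
    show "0 \<le> 1 - \<gamma>" using g by simp
    fix k assume "k < T"
    then have "L * b (Suc k) \<le> L * b k - mu * b k - (\<Delta> - \<delta>)"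
      using step[OF closest[of k]] Delta_le[of "Suc k"] by simp
    also have "\<dots> = L * ((1 - \<gamma>) * b k - (\<Delta> - \<delta>) / L)"
      using L(1) by (simp add: gamma_eq algebra_simps diff_divide_distrib)
    finally show "b (Suc k) \<le> (1 - \<gamma>) * b k - (\<Delta> - \<delta>) / L"
      using L(1) by (simp only: mult_le_cancel_left_pos)
  qed
  also have "(\<Sum>j<T. (1 - \<gamma>) ^ j) = (1 - ?q) / \<gamma>"
    using g by (simp add: sum_gp_strict)
  also have "(\<Delta> - \<delta>) / L * ((1 - ?q) / \<gamma>) = (\<Delta> - \<delta>) * ((1 - ?q) / mu)"
    using L(1) by (simp add: gamma_eq)
  finally have "(\<Delta> - \<delta>) * ((1 - ?q) / mu) \<le> ?q * b 0" using b0[of T] by simp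
  then have "\<Delta> - \<delta> \<le> ?q * mu / (1 - ?q) * b 0"
    using bounds(1) mu_pos by (simp add: field_simps)
  moreover have "?q * mu / (1 - ?q) * b 0 \<le> mu / (exp (\<gamma> * real T) - 1) * b 0"
    using mult_left_mono[OF bounds(2), of mu] mu_pos b0[of 0]
    by (intro mult_right_mono) (auto simp: mult.commute)
  moreover have "mu / (exp (\<gamma> * real T) - 1) * b 0 \<le> L / real T * b 0"
    using mult_left_mono[OF bounds(3), of mu] mu_pos b0[of 0] L(1)
    by (intro mult_right_mono) (auto simp: gamma_eq)
  ultimately show ?thesis by (simp add: b_def)
qed

end
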